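(* Let $c>0$. For $\ell>0$ consider the limiting ($d\to\infty$) model of a tempering algorithm with scaling $\ell$, whose transition probabilities $\mathcal A(\ell),\mathcal B(\ell),\mathcal C(\ell)=1-\mathcal A(\ell)-\mathcal B(\ell)$, acceptance rate $\mathrm{acc}(\ell)$ and efficiency $\mathrm{eff}(\ell)$ are as defined in the context. Then for every $\ell>0$: (i) In the reversible case, $\displaystyle \mathrm{eff}(\ell)=\mathrm{acc}(\ell)\,\frac{4}{c^2}\left[\Phi^{-1}\!\left(\frac{\mathrm{acc}(\ell)}{2}\right)\right]^2.$ (ii) In the non-reversible case, $\displaystyle \mathrm{eff}(\ell)=\frac{\mathrm{acc}(\ell)}{1-\mathrm{acc}(\ell)}\,\frac{4}{c^2}\left[\Phi^{-1}\!\left(\frac{\mathrm{acc}(\ell)}{2}\right)\right]^2.$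
   Context: $\Phi(z)=\int_{-\infty}^z\frac{1}{\sqrt{2\pi}}e^{-u^2/2}\,du$ is the standard normal distribution function, with inverse $\Phi^{-1}:(0,1)\to\mathbb{R}$. Model. A tempering algorithm's temperature index is modelled by the Markov chain on $\mathbb{Z}\times\{+,-\}$ that from $(i,+)$ moves to $(i+1,+)$, $(i-1,+)$, $(i,-)$ with probabilities $\mathcal A(\ell),\mathcal B(\ell),\mathcal C(\ell)$ respectively, and from $(i,-)$ moves to $(i-1,-)$, $(i+1,-)$, $(i,+)$ with probabilities $\mathcal A(\ell),\mathcal B(\ell),\mathcal C(\ell)$ respectively, where $\mathcal A(\ell)+\mathcal B(\ell)+\mathcal C(\ell)=1$, and where adjacent integers are regarded as being at distance $\ell$. In the limit as the dimension $d\to\infty$ (standing assumption of the framework), proposed temperature moves at scaling $\ell$ are accepted with probability $2\Phi(-c\ell/2)$, where $c>0$ is a problem-dependent constant. Reversible case: a move of $\pm1$ is proposed with probability $1/2$ each, so $\mathcal A(\ell)=\mathcal B(\ell)=\Phi(-c\ell/2)$. Non-reversible case: a move of $+1$ is always proposed on $\mathbb{Z}\times\{+\}$ and of $-1$ on $\mathbb{Z}\times\{-\}$, so $\mathcal B(\ell)=0$ and $\mathcal A(\ell)=2\Phi(-c\ell/2)$. In both cases the acceptance rate is $\mathrm{acc}(\ell):=\mathcal A(\ell)+\mathcal B(\ell)=2\Phi(-c\ell/2)$, and the efficiency is $\mathrm{eff}(\ell):=\ell^2 v(\ell)$ with $$v(\ell):=\frac{(\mathcal A(\ell)-\mathcal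 B(\ell))^2}{\mathcal C(\ell)}+\mathcal A(\ell)+\mathcal B(\ell).$$ *)

theory Defs
  imports "HOL-Probability.Probability"
begin

definition Phi :: "real \<Rightarrow> real" where
  "Phi z = (LBINT u:{..z}. std_normal_density u)"

lemma Phi_eq_cdf: "Phi = cdf std_normal_distribution"
proof
  fix z :: real
  have int: "integrable lborel (\<lambda>u. indicator {..z} u * std_normal_density u)"
    using integrable_real_mult_indicator[OF _ integrable_normal_density, of "{..z}" 1 0]
    by (simp add: mult.commute)
  have "measure std_normal_distribution {..z} = enn2real (\<integral>\<^sup>+u. ennreal (indicator {..z} u * std_normal_density u) \<partial>lborel)"
    unfolding measure_def
    by (subst emeasure_density) (auto intro!: arg_cong[where f=enn2real] nn_integral_cong split: split_indicator)
  also have "\<dots> = (LINT u|lborel. indicator {..z} u * std_normal_density u)"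
    by (subst nn_integral_eq_integral[OF int]) (auto intro!: enn2real_ennreal integral_nonneg)
  finally show "Phi z = cdf std_normal_distribution z"
    by (simp add: Phi_def cdf_def set_lebesgue_integral_def)
qed

lemma Phi_uminus: "Phi (- z) = 1 - Phi z"
proof -
  have i: "set_integrable lborel A std_normal_density" if "A \<in> sets lborel" for A
    using integrable_real_mult_indicator[OF that integrable_normal_density, of 1 0]
    by (simp add: set_integrable_def mult.commute)
  have "Phi (- z) = (LBINT u:{z..}. std_normal_density u)"
    unfolding Phi_def set_lebesgue_integral_def
    by (subst lborel_integral_real_affine[where c="-1" and t=0])
       (auto intro!: Bochner_Integration.integral_cong simp: normal_density_def split: split_indicator)
  also have "\<dots> = (LBINT u:{z<..}. std_normal_density u)"
    unfolding set_lebesgue_integral_def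
    by (intro integral_cong_AE)
       (auto intro!: AE_I[where N="{z}"] split: split_indicator)
  also have "Phi z + \<dots> = (LBINT u:{..z} \<union> {z<..}. std_normal_density u)"
    unfolding Phi_def by (rule set_integral_Un[symmetric]) (auto intro!: i)
  also have "{..z} \<union> {z<..} = UNIV" by auto
  also have "(LBINT u:UNIV. std_normal_density u) = 1"
    by (simp add: set_lebesgue_integral_def)
  finally show ?thesis by simp
qed

lemma Phi_diff: "x < y \<Longrightarrow> Phi y - Phi x = measure std_normal_distribution {x<..y}"
  unfolding Phi_eq_cdf
  using finite_borel_measure.cdf_diff_eq real_distribution.finite_borel_measure_M real_dist_normal_dist
  by blast

lemma strict_mono_Phi: "strict_mono Phi"
proof
  fix x y :: real assume "x < y"
  interpret real_distribution std_normal_distribution by (rule real_dist_normal_dist)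
  have "emeasure std_normal_distribution {x<..y} \<noteq> 0"
  proof
    assume "emeasure std_normal_distribution {x<..y} = 0"
    hence "AE u in lborel. u \<in> {x<..y} \<longrightarrow> False"
      by (subst (asm) emeasure_density)
         (auto simp: nn_integral_0_iff_AE normal_density_def indicator_def elim!: eventually_mono split: if_splits)
    hence "AE u in lborel. u \<notin> {x<..y}" by simp
    hence "emeasure lborel {x<..y} = 0"
      by (subst (asm) AE_iff_measurable[where N="{x<..y}"]) auto
    thus False using \<open>x < y\<close> by simp
  qed
  hence "measure std_normal_distribution {x<..y} > 0"
    by (simp add: zero_less_measure_iff emeasure_eq_measure)
  thus "Phi x < Phi y" using Phi_diff[OF \<open>x < y\<close>] by simp
qed

lemma Phi_half: "Phi 0 = 1 / 2"
  using Phi_uminus[of 0] by simp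

lemma Phi_pos: "0 < Phi z"
proof -
  have "0 \<le> Phi (z - 1)" unfolding Phi_eq_cdf cdf_def by simp
  also have "\<dots> < Phi z" by (rule strict_monoD[OF strict_mono_Phi]) simp
  finally show ?thesis .
qed

text \<open>\<open>Phi\<close> takes its values in \<open>(0, 1)\<close>; values of \<open>inv Phi\<close> outside
  \<open>(0, 1)\<close> are meaningless.\<close>

abbreviation Phi_inv :: "real \<Rightarrow> real" where
  "Phi_inv \<equiv> inv Phi"

datatype direction = Plus | Minus

fun flip :: "direction \<Rightarrow> direction" where
  "flip Plus = Minus"
| "flip Minus = Plus"

type_synonym state = "int \<times> direction"

text \<open>One step of the lifted chain: propose an increment of the temperature index, accept it
  with probability \<open>a\<close>, and on rejection keep the index but reverse the direction.\<close>

definition tempering_kernel :: "(direction \<Rightarrow> int pmf) \<Rightarrow> real \<Rightarrow> state \<Rightarrow> state pmf" where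
  "tempering_kernel proposal a = (\<lambda>(i, s).
     bind_pmf (proposal s) (\<lambda>m.
     bind_pmf (bernoulli_pmf a) (\<lambda>accepted.
     return_pmf (if accepted then (i + m, s) else (i, flip s)))))"

definition accept_prob :: "real \<Rightarrow> real \<Rightarrow> real" where
  "accept_prob c l = 2 * Phi (- c * l / 2)"

definition reversible_kernel :: "real \<Rightarrow> real \<Rightarrow> state \<Rightarrow> state pmf" where
  "reversible_kernel c l = tempering_kernel (\<lambda>_. pmf_of_set {1, -1}) (accept_prob c l)"

definition nonreversible_kernel :: "real \<Rightarrow> real \<Rightarrow> state \<Rightarrow> state pmf" where
  "nonreversible_kernel c l =
     tempering_kernel (\<lambda>s. return_pmf (case s of Plus \<Rightarrow> 1 | Minus \<Rightarrow> -1)) (accept_prob c l)"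

definition is_tempering_chain :: "(state \<Rightarrow> state pmf) \<Rightarrow> real \<Rightarrow> real \<Rightarrow> real \<Rightarrow> bool" where
  "is_tempering_chain K A B C \<longleftrightarrow> A + B + C = 1 \<and>
     (\<forall>i. pmf (K (i, Plus)) (i + 1, Plus) = A \<and> pmf (K (i, Plus)) (i - 1, Plus) = B \<and>
          pmf (K (i, Plus)) (i, Minus) = C \<and>
          pmf (K (i, Minus)) (i - 1, Minus) = A \<and> pmf (K (i, Minus)) (i + 1, Minus) = B \<and>
          pmf (K (i, Minus)) (i, Plus) = C)"

text \<open>The probabilities \<open>A\<close>, \<open>B\<close>, \<open>C\<close> of a chain satisfying
  \<^term>\<open>is_tempering_chain\<close> are the same at every index and may be read off at \<open>(0, +)\<close>.
  Both kernels above are such chains, see \<open>is_tempering_chain_reversible\<close> and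
  \<open>is_tempering_chain_nonreversible\<close> below.\<close>

definition prob_A :: "(state \<Rightarrow> state pmf) \<Rightarrow> real" where
  "prob_A K = pmf (K (0, Plus)) (1, Plus)"

definition prob_B :: "(state \<Rightarrow> state pmf) \<Rightarrow> real" where
  "prob_B K = pmf (K (0, Plus)) (-1, Plus)"

definition prob_C :: "(state \<Rightarrow> state pmf) \<Rightarrow> real" where
  "prob_C K = pmf (K (0, Plus)) (0, Minus)"

definition acc :: "(state \<Rightarrow> state pmf) \<Rightarrow> real" where
  "acc K = prob_A K + prob_B K"

definition speed :: "(state \<Rightarrow> state pmf) \<Rightarrow> real" where
  "speed K = (prob_A K - prob_B K)\<^sup>2 / prob_C K + prob_A K + prob_B K"

text \<open>Adjacent integers are at distance \<open>l\<close>, whence the factor \<open>l\<^sup>2\<close>.\<close>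

definition eff :: "real \<Rightarrow> (state \<Rightarrow> state pmf) \<Rightarrow> real" where
  "eff l K = l\<^sup>2 * speed K"

lemma accept_prob_bounds:
  assumes "c > 0" "l > 0"
  shows "0 < accept_prob c l" "accept_prob c l < 1"
proof -
  have "- c * l / 2 < 0" using assms by simp
  from strict_monoD[OF strict_mono_Phi this] show "accept_prob c l < 1"
    by (simp add: accept_prob_def Phi_half)
qed (simp add: accept_prob_def Phi_pos)

lemma tempering_kernel_pmf:
  assumes "0 \<le> a" "a \<le> 1"
  shows "pmf (tempering_kernel proposal a (i, s)) (j, t) =
    measure_pmf.expectation (proposal s)
      (\<lambda>m. a * of_bool (j = i + m \<and> t = s) + (1 - a) * of_bool (j = i \<and> t = flip s))"
  using assms
  by (auto simp: tempering_kernel_def pmf_bind intro!: Bochner_Integration.integral_cong)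

lemma is_tempering_chain_reversible:
  assumes "c > 0" "l > 0"
  shows "is_tempering_chain (reversible_kernel c l)
    (Phi (- c * l / 2)) (Phi (- c * l / 2)) (1 - 2 * Phi (- c * l / 2))"
  using accept_prob_bounds[OF assms]
  by (auto simp: is_tempering_chain_def reversible_kernel_def tempering_kernel_pmf
      integral_pmf_of_set accept_prob_def)

lemma is_tempering_chain_nonreversible:
  assumes "c > 0" "l > 0"
  shows "is_tempering_chain (nonreversible_kernel c l)
    (2 * Phi (- c * l / 2)) 0 (1 - 2 * Phi (- c * l / 2))"
  using accept_prob_bounds[OF assms]
  by (auto simp: is_tempering_chain_def nonreversible_kernel_def tempering_kernel_pmf
      accept_prob_def)

end

theory Submission
  imports Defs
begin

text \<open>In both cases the acceptance rate is a = 2 \<open>Phi (- c * l / 2)\<close>. As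
  \<open>Phi\<close> is strictly increasing, this can be solved for the scaling, which expresses l^2
  through a (\<open>square_Phi_inv_accept_prob\<close>). It remains to write the speed in terms of
  a: with A = B the squared drift vanishes and a is left, while with B = 0, A = a and C = 1 - a the
  drift term raises it to a / (1 - a).\<close>

lemma tempering_chain_probs:
  assumes "is_tempering_chain K A B C"
  shows "prob_A K = A" "prob_B K = B" "prob_C K = C"
proof -
  have "pmf (K (0, Plus)) (0 + 1, Plus) = A" "pmf (K (0, Plus)) (0 - 1, Plus) = B"
    "pmf (K (0, Plus)) (0, Minus) = C"
    using assms unfolding is_tempering_chain_def by blast+
  then show "prob_A K = A" "prob_B K = B" "prob_C K = C"
    by (simp_all add: prob_A_def prob_B_def prob_C_def)
qed

lemma Phi_inv_Phi: "Phi_inv (Phi z) = z"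
  by (rule inv_f_f[OF strict_mono_imp_inj_on[OF strict_mono_Phi]])

text \<open>Inverting the acceptance formula gives l = -(2 / c)
  \<open>Phi_inv (accept_prob c l / 2)\<close>; squaring removes the sign.\<close>

lemma square_Phi_inv_accept_prob:
  assumes "c \<noteq> 0"
  shows "4 / c\<^sup>2 * (Phi_inv (accept_prob c l / 2))\<^sup>2 = l\<^sup>2"
proof -
  have "Phi_inv (accept_prob c l / 2) = - c * l / 2"
    using Phi_inv_Phi[of "- c * l / 2"] by (simp add: accept_prob_def)
  with assms show ?thesis
    by (simp add: power_divide power_mult_distrib)
qed

theorem theorem4:
  fixes c l :: real
  assumes "c > 0" and "l > 0"
  shows "eff l (reversible_kernel c l) =
           acc (reversible_kernel c l) * (4 / c\<^sup>2) *
             (Phi_inv (acc (reversible_kernel c l) / 2))\<^sup>2 \<and>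
         eff l (nonreversible_kernel c l) =
           acc (nonreversible_kernel c l) / (1 - acc (nonreversible_kernel c l)) * (4 / c\<^sup>2) *
             (Phi_inv (acc (nonreversible_kernel c l) / 2))\<^sup>2"
proof -
  define a where "a = accept_prob c l"
  have "a < 1"
    unfolding a_def using assms by (rule accept_prob_bounds)
  have l2: "4 / c\<^sup>2 * (Phi_inv (a / 2))\<^sup>2 = l\<^sup>2"
    unfolding a_def using assms by (intro square_Phi_inv_accept_prob) simp
  note rev = tempering_chain_probs[OF is_tempering_chain_reversible[OF assms]]
  note nonrev = tempering_chain_probs[OF is_tempering_chain_nonreversible[OF assms]]
  have acc: "acc (reversible_kernel c l) = a" "acc (nonreversible_kernel c l) = a"
    by (simp_all add: acc_def rev nonrev a_def accept_prob_def)
  have "speed (reversible_kernel c l) = a"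
    by (simp add: speed_def rev a_def accept_prob_def)
  moreover have "speed (nonreversible_kernel c l) = a\<^sup>2 / (1 - a) + a"
    by (simp add: speed_def nonrev a_def accept_prob_def)
  \<comment> \<open>Over the common denominator the numerator is a^2 + a (1 - a) = a;
    \<open>a < 1\<close> keeps that denominator nonzero.\<close>
  moreover have "a\<^sup>2 / (1 - a) + a = a / (1 - a)"
    using \<open>a < 1\<close> by (simp add: field_simps power2_eq_square)
  ultimately show ?thesis
    \<comment> \<open>Reassociating makes the product in \<open>l2\<close> appear as a factor, so
      both right-hand sides become speed times l^2.\<close>
    unfolding eff_def acc mult.assoc l2 by simp
qed

end
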